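(* Let $V=\{1,\dots,n\}$, let $f:2^V\to\mathbb R_+$ be a non-negative, non-decreasing submodular function with $f(\emptyset)=0$, and let $\mathbf a,\mathbf b\in\mathbb R^n_+$ be non-negative vectors with $a_1\le\cdots\le a_n$ and $b_1\ge\cdots\ge b_n$. Consider the zero-sum game in which Player 1 (maximizer) has mixed strategy set $\mathcal B(f)$, Player 2 (minimizer) has mixed strategy set $\Delta(\mathbf a)+\Delta(\mathbf b)$, and the payoff is $P(\mathbf x,\mathbf y)=\mathbf x^T\mathbf y$. Let $$k=\min\Big\{\ell:\ \sum_{i=\ell+1}^n\frac1{b_i}\le\sum_{i=1}^{\ell}\frac1{a_i}\Big\}$$ and $$\mathbf y^k=\lambda_k\mathbf 1,\qquad \lambda_k=\frac{a_k+b_k}{a_k\sum_{i=1}^k1/a_i+b_k\sum_{i=k+1}^n1/b_i},$$ where $\mathbf 1$ is the vector of ones. Then $\mathbf y^k$ is a mixed strategy for Player 2, and $$P(\mathbf x,\mathbf y^k)\le v_k\equiv\lambda_kf(V)$$ for every Player 1 strategy $\mathbf x\in\mathcal B(f)$. Furthermore, the strategy $\mathbf y^k$ is optimal if $\mathbf x^k$ lies in $\mathcal B(f)$, where $$(\mathbf x^k)^T=\frac{\lambda_kf(V)}{a_k+b_k}\Big(\frac{a_k}{a_1},\dots,\frac{a_k}{a_k},\frac{b_k}{b_{k+1}},\dots,\frac{b_k}{b_n}\Big).$$ In this case, $\mathbf x^k$ is also optimal, and the value of the game is $v_k$.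
   Context: $\mathcal B(f)=\{\mathbf x\in\mathbb R^n_+:\mathbf x(S)\le f(S)\text{ for all }S\subseteq V,\ \mathbf x(V)=f(V)\}$, with $\mathbf x(S)=\sum_{i\in S}x_i$, is the base of the polymatroid associated with $f$; its vertices are Player 1's pure strategies. For $\mathbf w\in\mathbb R^n_+$, $\Delta(\mathbf w)=\{\sum_{i=1}^n\theta_iw_i\mathbf e^i:\theta_i\ge0,\ \sum_{i=1}^n\theta_i=1\}$, where $\mathbf e^i$ is the $i$-th standard unit vector. $\Delta(\mathbf a)+\Delta(\mathbf b)$ is the Minkowski sum, which is the convex hull of Player 2's pure strategies $a_i\mathbf e^i+b_j\mathbf e^j$, $(i,j)\in V^2$. Optimal strategies are max-min for Player 1 and min-max for Player 2, and the value of the game is the common max-min/min-max payoff.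
   Formalization: Since entries of a and b may be zero, where the printed formulas are undefined, 1/0 is read as ∞, a_k·Σ1/a_i as Σ a_k/a_i (likewise for b) with 0/0 read as 1, and x^k is taken to be 0 when a_1 = b_n = 0 and n ≥ 2 or b_1 = 0; for positive entries the formulas are as printed. *)

theory Defs
  imports "HOL-Analysis.Analysis" "HOL-Library.Function_Algebras" "HOL-Library.Set_Algebras"
begin

text \<open>
  A vector of \<open>\<real>\<^sup>n\<close> with coordinates indexed by \<open>{1..n}\<close> is a function \<open>nat \<Rightarrow> real\<close> that
  vanishes outside \<open>{1..n}\<close>. Addition of functions is pointwise, so \<open>A + B\<close> on sets of such
  functions is the Minkowski sum.
\<close>

definition submodular_on :: "'a set \<Rightarrow> ('a set \<Rightarrow> real) \<Rightarrow> bool" where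
  "submodular_on V f \<longleftrightarrow> (\<forall>S T. S \<subseteq> V \<longrightarrow> T \<subseteq> V \<longrightarrow> f (S \<union> T) + f (S \<inter> T) \<le> f S + f T)"

definition base_polytope :: "nat \<Rightarrow> (nat set \<Rightarrow> real) \<Rightarrow> (nat \<Rightarrow> real) set" where
  "base_polytope n f =
     {x. (\<forall>i\<in>{1..n}. 0 \<le> x i) \<and> (\<forall>i. i \<notin> {1..n} \<longrightarrow> x i = 0) \<and>
         (\<forall>S. S \<subseteq> {1..n} \<longrightarrow> sum x S \<le> f S) \<and> sum x {1..n} = f {1..n}}"

definition scaled_simplex :: "nat \<Rightarrow> (nat \<Rightarrow> real) \<Rightarrow> (nat \<Rightarrow> real) set" where
  "scaled_simplex n w =
     {(\<lambda>j. \<Sum>i=1..n. \<theta> i * w i * indicator {i} j) | \<theta>.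
        (\<forall>i\<in>{1..n}. 0 \<le> \<theta> i) \<and> (\<Sum>i=1..n. \<theta> i) = 1}"

definition payoff :: "nat \<Rightarrow> (nat \<Rightarrow> real) \<Rightarrow> (nat \<Rightarrow> real) \<Rightarrow> real" where
  "payoff n x y = (\<Sum>i=1..n. x i * y i)"


text \<open>
  Zero-sum games with strategy sets \<open>X\<close> (maximizer) and \<open>Y\<close> (minimizer). Infima and suprema
  are taken in the complete lattice \<^typ>\<open>ereal\<close>, so that they are never junk values.
\<close>

definition maxmin_optimal :: "'a set \<Rightarrow> 'b set \<Rightarrow> ('a \<Rightarrow> 'b \<Rightarrow> real) \<Rightarrow> 'a \<Rightarrow> bool" where
  "maxmin_optimal X Y P = is_arg_max (\<lambda>x. INF y\<in>Y. ereal (P x y)) (\<lambda>x. x \<in> X)"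

definition minmax_optimal :: "'a set \<Rightarrow> 'b set \<Rightarrow> ('a \<Rightarrow> 'b \<Rightarrow> real) \<Rightarrow> 'b \<Rightarrow> bool" where
  "minmax_optimal X Y P = is_arg_min (\<lambda>y. SUP x\<in>X. ereal (P x y)) (\<lambda>y. y \<in> Y)"

definition is_game_value :: "'a set \<Rightarrow> 'b set \<Rightarrow> ('a \<Rightarrow> 'b \<Rightarrow> real) \<Rightarrow> real \<Rightarrow> bool" where
  "is_game_value X Y P v \<longleftrightarrow>
     (SUP x\<in>X. INF y\<in>Y. ereal (P x y)) = ereal v \<and>
     (INF y\<in>Y. SUP x\<in>X. ereal (P x y)) = ereal v"


text \<open>
  The entries of \<open>a\<close> and \<open>b\<close> may be zero, so reciprocals are extended reals with
  \<open>1 / 0 = \<infinity>\<close>, which is the value of division on \<^typ>\<open>ereal\<close>.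
\<close>

definition switch_index :: "nat \<Rightarrow> (nat \<Rightarrow> real) \<Rightarrow> (nat \<Rightarrow> real) \<Rightarrow> nat" where
  "switch_index n a b =
     (LEAST l. l \<le> n \<and> (\<Sum>i=l+1..n. 1 / ereal (b i)) \<le> (\<Sum>i=1..l. 1 / ereal (a i)))"

text \<open>
  In \<open>a\<^sub>k * (\<Sum>i=1..k. 1 / a\<^sub>i)\<close> the term for \<open>i = k\<close> is \<open>a\<^sub>k / a\<^sub>k = 1\<close>, also when
  \<open>a\<^sub>k = 0\<close>. In \<^typ>\<open>ereal\<close> both \<open>0 * \<infinity>\<close> and \<open>0 / 0\<close> are \<open>0\<close>; hence the factor is
  distributed over the sum and \<open>0 / 0\<close> is replaced by \<open>1\<close>.
\<close>

definition ratio :: "real \<Rightarrow> real \<Rightarrow> ereal" where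
  "ratio p q = (if p = 0 \<and> q = 0 then 1 else ereal p / ereal q)"

definition eq_level :: "nat \<Rightarrow> (nat \<Rightarrow> real) \<Rightarrow> (nat \<Rightarrow> real) \<Rightarrow> nat \<Rightarrow> real" where
  "eq_level n a b k = real_of_ereal
     (ereal (a k + b k) / ((\<Sum>i=1..k. ratio (a k) (a i)) + (\<Sum>i=k+1..n. ratio (b k) (b i))))"

definition y_strategy :: "nat \<Rightarrow> (nat \<Rightarrow> real) \<Rightarrow> (nat \<Rightarrow> real) \<Rightarrow> nat \<Rightarrow> nat \<Rightarrow> real" where
  "y_strategy n a b k = (\<lambda>i. eq_level n a b k * indicator {1..n} i)"

text \<open>
  For \<open>k = switch_index n a b\<close>, an infinite ratio below occurs only if \<open>a 1 = 0\<close>, \<open>b n = 0\<close>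
  and \<open>b 1 > 0\<close>; then \<open>eq_level n a b k = 0\<close>, so its image under \<^const>\<open>real_of_ereal\<close> is
  multiplied by \<open>0\<close>. The case \<open>a k + b k = 0\<close> occurs only if \<open>a 1 = 0\<close> and \<open>b\<close> vanishes on
  \<open>{1..n}\<close>; then \<open>eq_level n a b k = 0\<close> and the vector below is zero.
\<close>

definition x_strategy ::
  "nat \<Rightarrow> (nat set \<Rightarrow> real) \<Rightarrow> (nat \<Rightarrow> real) \<Rightarrow> (nat \<Rightarrow> real) \<Rightarrow> nat \<Rightarrow> nat \<Rightarrow> real" where
  "x_strategy n f a b k =
     (\<lambda>i. if i \<in> {1..n} then
            eq_level n a b k * f {1..n} / (a k + b k) *
              real_of_ereal (if i \<le> k then ratio (a k) (a i) else ratio (b k) (b i))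
          else 0)"


text \<open>For positive vectors these are the usual formulas over the reals.\<close>

lemma recip_pos: "0 < q \<Longrightarrow> 1 / ereal q = ereal (1 / q)"
  by (simp add: one_ereal_def)

lemma ratio_pos: "0 < q \<Longrightarrow> ratio p q = ereal (p / q)"
  by (simp add: ratio_def)

lemma switch_index_pos:
  assumes "\<And>i. i \<in> {1..n} \<Longrightarrow> 0 < a i" "\<And>i. i \<in> {1..n} \<Longrightarrow> 0 < b i"
  shows "switch_index n a b = (LEAST l. l \<le> n \<and> (\<Sum>i=l+1..n. 1 / b i) \<le> (\<Sum>i=1..l. 1 / a i))"
proof -
  have "(\<Sum>i=l+1..n. 1 / ereal (b i)) = ereal (\<Sum>i=l+1..n. 1 / b i)" for l
    unfolding sum_ereal[symmetric] by (rule sum.cong) (auto simp: assms recip_pos)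
  moreover have "(\<Sum>i=1..l. 1 / ereal (a i)) = ereal (\<Sum>i=1..l. 1 / a i)" if "l \<le> n" for l
    unfolding sum_ereal[symmetric] by (rule sum.cong) (use that in \<open>auto simp: assms recip_pos\<close>)
  ultimately show ?thesis
    unfolding switch_index_def by (metis (no_types, lifting) ereal_less_eq(3))
qed

lemma eq_level_pos:
  assumes "\<And>i. i \<in> {1..n} \<Longrightarrow> 0 < a i" "\<And>i. i \<in> {1..n} \<Longrightarrow> 0 < b i" and k: "k \<in> {1..n}"
  shows "eq_level n a b k =
    (a k + b k) / (a k * (\<Sum>i=1..k. 1 / a i) + b k * (\<Sum>i=k+1..n. 1 / b i))"
proof -
  have A: "(\<Sum>i=1..k. ratio (a k) (a i)) = ereal (a k * (\<Sum>i=1..k. 1 / a i))"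
    unfolding sum_distrib_left sum_ereal[symmetric]
    by (rule sum.cong) (use k in \<open>auto simp: assms ratio_pos\<close>)
  have B: "(\<Sum>i=k+1..n. ratio (b k) (b i)) = ereal (b k * (\<Sum>i=k+1..n. 1 / b i))"
    unfolding sum_distrib_left sum_ereal[symmetric]
    by (rule sum.cong) (auto simp: assms ratio_pos)
  have "0 < a k * (\<Sum>i=1..k. 1 / a i)"
    using k by (intro mult_pos_pos sum_pos) (auto simp: assms)
  moreover have "0 \<le> b k * (\<Sum>i=k+1..n. 1 / b i)"
    using k assms(2) by (intro mult_nonneg_nonneg sum_nonneg) (auto simp: less_imp_le)
  ultimately show ?thesis
    unfolding eq_level_def A B by simp
qed

lemma x_strategy_pos:
  assumes "\<And>i. i \<in> {1..n} \<Longrightarrow> 0 < a i" "\<And>i. i \<in> {1..n} \<Longrightarrow> 0 < b i" and "i \<in> {1..n}"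
  shows "x_strategy n f a b k i =
    eq_level n a b k * f {1..n} / (a k + b k) * (if i \<le> k then a k / a i else b k / b i)"
  using assms by (simp add: x_strategy_def ratio_pos)

end

theory Submission
  imports Defs
begin

text \<open>
  The pair \<open>(x\<^sup>k, y\<^sup>k)\<close> is a saddle point. Every \<open>x\<close> in the base has the same
  payoff \<open>\<lambda>\<^sub>k f(V)\<close> against the constant vector \<open>y\<^sup>k\<close>. Conversely, with
  \<open>c = \<lambda>\<^sub>k f(V) / (a\<^sub>k + b\<^sub>k)\<close>, the monotonicity of \<open>a\<close> and \<open>b\<close> gives
  \<open>x\<^sup>k\<^sub>i a\<^sub>i \<ge> c a\<^sub>k\<close> and \<open>x\<^sup>k\<^sub>i b\<^sub>i \<ge> c b\<^sub>k\<close> for all \<open>i\<close>, so \<open>x\<^sup>k\<close> guarantees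
  \<open>c (a\<^sub>k + b\<^sub>k)\<close> against every \<open>y\<close>. To write \<open>y\<^sup>k\<close> as a mixed strategy, level the
  coordinates below \<open>k\<close> with \<open>a\<close> alone and those above \<open>k\<close> with \<open>b\<close> alone, and put the
  remaining weights on \<open>k\<close>; the choice of \<open>k\<close> makes these weights nonnegative.
\<close>

section \<open>Saddle points and optimal strategies\<close>

text \<open>Since \<open>y0\<close> is available to the minimizer, \<open>le\<close> caps every
  inner infimum at \<open>v\<close>; dually, \<open>ge\<close> keeps every inner supremum at least
  \<open>v\<close>. Both bounds are attained at the pair itself, so the two outer optima equal
  \<open>v\<close>.\<close>

lemma saddle_point_optimal:
  fixes P :: "'a \<Rightarrow> 'b \<Rightarrow> real"
  assumes "x0 \<in> X" "y0 \<in> Y"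
    and le: "\<And>x. x \<in> X \<Longrightarrow> P x y0 \<le> v"
    and ge: "\<And>y. y \<in> Y \<Longrightarrow> v \<le> P x0 y"
  shows "minmax_optimal X Y P y0" "maxmin_optimal X Y P x0" "is_game_value X Y P v"
proof -
  have inf_le: "(INF y\<in>Y. ereal (P x y)) \<le> ereal v" if "x \<in> X" for x
    using le[OF that] by (intro INF_lower2[OF \<open>y0 \<in> Y\<close>]) simp
  have sup_ge: "ereal v \<le> (SUP x\<in>X. ereal (P x y))" if "y \<in> Y" for y
    using ge[OF that] by (intro SUP_upper2[OF \<open>x0 \<in> X\<close>]) simp
  have inf: "(INF y\<in>Y. ereal (P x0 y)) = ereal v"
    by (intro antisym inf_le INF_greatest) (simp_all add: assms)
  have sup: "(SUP x\<in>X. ereal (P x y0)) = ereal v"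
    by (intro antisym sup_ge SUP_least) (simp_all add: assms)
  show "minmax_optimal X Y P y0"
    unfolding minmax_optimal_def is_arg_min_def sup
    using \<open>y0 \<in> Y\<close> sup_ge by (auto simp: not_less)
  show "maxmin_optimal X Y P x0"
    unfolding maxmin_optimal_def is_arg_max_def inf
    using \<open>x0 \<in> X\<close> inf_le by (auto simp: not_less)
  have "(SUP x\<in>X. INF y\<in>Y. ereal (P x y)) = ereal v"
    by (rule antisym[OF SUP_least SUP_upper2[OF \<open>x0 \<in> X\<close>]]) (simp_all add: inf_le inf)
  moreover have "(INF y\<in>Y. SUP x\<in>X. ereal (P x y)) = ereal v"
    by (rule antisym[OF INF_lower2[OF \<open>y0 \<in> Y\<close>] INF_greatest]) (simp_all add: sup_ge sup)
  ultimately show "is_game_value X Y P v"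
    by (simp add: is_game_value_def)
qed

section \<open>Coordinates of the mixed strategies of Player 2\<close>

lemma scaled_simplex_eq:
  "scaled_simplex n w =
     {(\<lambda>j. if j \<in> {1..n} then \<theta> j * w j else 0) | \<theta>.
        (\<forall>i\<in>{1..n}. 0 \<le> \<theta> i) \<and> (\<Sum>i=1..n. \<theta> i) = 1}"
proof -
  have "(\<Sum>i=1..n. \<theta> i * w i * indicator {i} j) = (if j \<in> {1..n} then \<theta> j * w j else 0)"
    for \<theta> :: "nat \<Rightarrow> real" and j
  proof -
    have "(\<Sum>i=1..n. \<theta> i * w i * indicator {i} j) = (\<Sum>i=1..n. if i = j then \<theta> i * w i else 0)"
      by (rule sum.cong) auto
    then show ?thesis by simp
  qed
  then show ?thesis
    unfolding scaled_simplex_def by simp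
qed

text \<open>Exposes the two weight vectors, so that membership is shown by exhibiting
  \<open>\<theta>\<close> and \<open>\<phi>\<close> and exploited by averaging over them.\<close>

lemma scaled_simplex_plus_eq:
  "scaled_simplex n a + scaled_simplex n b =
     {(\<lambda>j. if j \<in> {1..n} then \<theta> j * a j + \<phi> j * b j else 0) | \<theta> \<phi>.
        (\<forall>i\<in>{1..n}. 0 \<le> \<theta> i) \<and> (\<Sum>i=1..n. \<theta> i) = 1 \<and>
        (\<forall>i\<in>{1..n}. 0 \<le> \<phi> i) \<and> (\<Sum>i=1..n. \<phi> i) = 1}" (is "_ = ?R")
proof -
  have plus: "(\<lambda>j. if j \<in> {1..n} then \<theta> j * a j else 0) + (\<lambda>j. if j \<in> {1..n} then \<phi> j * b j else 0)
      = (\<lambda>j. if j \<in> {1..n} then \<theta> j * a j + \<phi> j * b j else 0)" for \<theta> \<phi> :: "nat \<Rightarrow> real"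
    by (auto simp: fun_eq_iff)
  show ?thesis
  proof (intro equalityI subsetI)
    fix y assume "y \<in> scaled_simplex n a + scaled_simplex n b"
    then show "y \<in> ?R"
      unfolding set_plus_def scaled_simplex_eq using plus by blast
  next
    fix y assume "y \<in> ?R"
    then show "y \<in> scaled_simplex n a + scaled_simplex n b"
      unfolding plus[symmetric] unfolding set_plus_def scaled_simplex_eq by blast
  qed
qed

lemma sum_split_at:
  fixes g :: "nat \<Rightarrow> 'a::comm_monoid_add"
  assumes "k \<in> {1..n}"
  shows "(\<Sum>i=1..n. g i) = (\<Sum>i\<in>{1..<k}. g i) + g k + (\<Sum>i\<in>{k<..n}. g i)"
proof -
  have "{1..n} = {1..<k} \<union> insert k {k<..n}"
    using assms by auto
  then have "(\<Sum>i=1..n. g i) = (\<Sum>i\<in>{1..<k}. g i) + (\<Sum>i\<in>insert k {k<..n}. g i)"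
    by (simp only:) (rule sum.union_disjoint, auto)
  then show ?thesis
    by (simp add: add.assoc)
qed

section \<open>The switching index\<close>

text \<open>The two inequalities are the defining condition at \<open>k\<close> and its failure at
  \<open>k - 1\<close>. The index lies in \<open>{1..n}\<close> because the condition holds at
  \<open>n\<close>, where the left sum is empty, and fails at 0, where the right sum is empty and
  the left one positive.\<close>

lemma switch_index_properties:
  assumes "1 \<le> n" and "\<And>i. i \<in> {1..n} \<Longrightarrow> 0 \<le> b i"
    and "k = switch_index n a b" and "\<And>i. i \<in> {1..n} \<Longrightarrow> 0 \<le> a i"
  shows "k \<in> {1..n}"
    and "(\<Sum>i\<in>{k<..n}. 1 / ereal (b i)) \<le> (\<Sum>i\<in>{1..<k}. 1 / ereal (a i)) + 1 / ereal (a k)"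
    and "(\<Sum>i\<in>{1..<k}. 1 / ereal (a i)) < 1 / ereal (b k) + (\<Sum>i\<in>{k<..n}. 1 / ereal (b i))"
proof -
  define Q where "Q l \<longleftrightarrow> l \<le> n \<and>
    (\<Sum>i=l+1..n. 1 / ereal (b i)) \<le> (\<Sum>i=1..l. 1 / ereal (a i))" for l
  have k: "k = (LEAST l. Q l)"
    using assms(3) unfolding switch_index_def Q_def .
  have recip: "0 < 1 / ereal (b i)" if "i \<in> {1..n}" for i
  proof (cases "b i = 0")
    case True
    then show ?thesis by (simp add: zero_ereal_def[symmetric] divide_ereal_def)
  next
    case False
    then show ?thesis using assms(2)[OF that] by (simp add: recip_pos)
  qed
  have "\<not> Q 0"
  proof
    assume "Q 0"
    then have "(\<Sum>i=1..n. 1 / ereal (b i)) \<le> 0"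
      by (simp add: Q_def)
    moreover have "1 / ereal (b 1) \<le> (\<Sum>i=1..n. 1 / ereal (b i))"
      using sum_mono2[of "{1..n}" "{1}" "\<lambda>i. 1 / ereal (b i)"] recip \<open>1 \<le> n\<close> by (simp add: less_imp_le)
    ultimately show False
      using recip[of 1] \<open>1 \<le> n\<close> by auto
  qed
  have "Q n"
    unfolding Q_def using assms(4) by (auto intro!: sum_nonneg simp: zero_le_divide_ereal)
  then have "Q k"
    unfolding k by (rule LeastI)
  have "k \<noteq> 0"
    using \<open>Q k\<close> \<open>\<not> Q 0\<close> by metis
  have "\<not> Q (k - 1)"
    using not_less_Least[of "k - 1" Q] \<open>k \<noteq> 0\<close> k by simp
  show "k \<in> {1..n}"
    using \<open>Q k\<close> \<open>k \<noteq> 0\<close> by (auto simp: Q_def)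
  have "{1..k} = insert k {1..<k}" "{k+1..n} = {k<..n}"
    "{k..n} = insert k {k<..n}" "{1..k-1} = {1..<k}"
    using \<open>k \<in> {1..n}\<close> by auto
  note sets = this
  show "(\<Sum>i\<in>{k<..n}. 1 / ereal (b i)) \<le> (\<Sum>i\<in>{1..<k}. 1 / ereal (a i)) + 1 / ereal (a k)"
    using \<open>Q k\<close> unfolding Q_def sets by (simp add: add.commute)
  \<comment> \<open>As \<open>k - 1 \<le> n\<close>, only the inequality in \<open>Q (k - 1)\<close>
    can fail; \<open>k \<noteq> 0\<close> makes its left sum start at \<open>k\<close>.\<close>
  show "(\<Sum>i\<in>{1..<k}. 1 / ereal (a i)) < 1 / ereal (b k) + (\<Sum>i\<in>{k<..n}. 1 / ereal (b i))"
    using \<open>\<not> Q (k - 1)\<close> \<open>k \<in> {1..n}\<close> unfolding Q_def sets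
    by (auto simp: not_le sets)
qed

section \<open>The equalizing level\<close>

lemma sum_recip_ereal:
  assumes "\<And>i. i \<in> I \<Longrightarrow> 0 < w i"
  shows "(\<Sum>i\<in>I. 1 / ereal (w i)) = ereal (\<Sum>i\<in>I. 1 / w i)"
  unfolding sum_ereal[symmetric] by (rule sum.cong) (auto simp: assms recip_pos)

lemma sum_ratio_ereal:
  assumes "\<And>i. i \<in> I \<Longrightarrow> 0 < w i"
  shows "(\<Sum>i\<in>I. ratio p (w i)) = ereal (p * (\<Sum>i\<in>I. 1 / w i))"
  unfolding sum_distrib_left sum_ereal[symmetric] by (rule sum.cong) (auto simp: assms ratio_pos)

lemma ratio_self: "0 \<le> p \<Longrightarrow> ratio p p = 1"
  by (simp add: ratio_def one_ereal_def)

text \<open>The term for \<open>i = k\<close> is pulled out as the explicit 1, which covers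
  \<open>a k = 0\<close> too. All other ratios have positive denominators, so the total is finite
  and at least 1, and \<open>real_of_ereal\<close> returns the true quotient.\<close>

lemma eq_level_regular:
  assumes "k \<in> {1..n}" "0 \<le> a k" "0 \<le> b k"
    and "\<And>i. i \<in> {1..<k} \<Longrightarrow> 0 < a i" "\<And>i. i \<in> {k<..n} \<Longrightarrow> 0 < b i"
  shows "eq_level n a b k =
    (a k + b k) / (1 + a k * (\<Sum>i\<in>{1..<k}. 1 / a i) + b k * (\<Sum>i\<in>{k<..n}. 1 / b i))"
proof -
  have "{1..k} = insert k {1..<k}" "{k+1..n} = {k<..n}"
    using \<open>k \<in> {1..n}\<close> by auto
  note sets = this
  define P Q where "P = a k * (\<Sum>i\<in>{1..<k}. 1 / a i)"
    and "Q = b k * (\<Sum>i\<in>{k<..n}. 1 / b i)"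
  have "(\<Sum>i\<in>{1..<k}. ratio (a k) (a i)) = ereal P" "(\<Sum>i\<in>{k<..n}. ratio (b k) (b i)) = ereal Q"
    unfolding P_def Q_def by (auto intro!: sum_ratio_ereal assms)
  then have "(\<Sum>i=1..k. ratio (a k) (a i)) + (\<Sum>i=k+1..n. ratio (b k) (b i)) = ereal (1 + P + Q)"
    unfolding sets using \<open>0 \<le> a k\<close> by (simp add: ratio_self one_ereal_def del: One_nat_def)
  moreover have "0 \<le> P" "0 \<le> Q"
    using assms unfolding P_def Q_def
    by (auto intro!: mult_nonneg_nonneg sum_nonneg simp: less_imp_le)
  ultimately show ?thesis
    unfolding eq_level_def P_def[symmetric] Q_def[symmetric] by simp
qed

text \<open>Here the index \<open>i\<close> makes the denominator of \<open>\<lambda>\<^sub>k\<close> infinite, unless \<open>b k = 0\<close>.\<close>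

lemma eq_level_degenerate:
  assumes "a k = 0" "0 \<le> b k" "i \<in> {k<..n}" "b i = 0"
  shows "eq_level n a b k = 0"
proof (cases "b k = 0")
  case False
  then have "ratio (b k) (b i) = \<infinity>"
    using assms by (simp add: ratio_def)
  moreover have "i \<in> {k+1..n}"
    using assms(3) by simp
  ultimately have "(\<Sum>i=k+1..n. ratio (b k) (b i)) = \<infinity>"
    by (subst sum_Pinfty) blast
  then show ?thesis
    by (simp add: eq_level_def)
qed (use assms in \<open>simp add: eq_level_def flip: zero_ereal_def\<close>)

section \<open>Weights that produce the constant vector\<close>

lemma y_strategy_mem_regular:
  assumes "k \<in> {1..n}" "0 \<le> a k" "0 \<le> b k"
    and a_pos: "\<And>i. i \<in> {1..<k} \<Longrightarrow> 0 < a i" and b_pos: "\<And>i. i \<in> {k<..n} \<Longrightarrow> 0 < b i"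
    and "b k * (\<Sum>i\<in>{1..<k}. 1 / a i) \<le> 1 + b k * (\<Sum>i\<in>{k<..n}. 1 / b i)"
    and "a k * (\<Sum>i\<in>{k<..n}. 1 / b i) \<le> 1 + a k * (\<Sum>i\<in>{1..<k}. 1 / a i)"
  shows "y_strategy n a b k \<in> scaled_simplex n a + scaled_simplex n b"
proof -
  define H T where "H = (\<Sum>i\<in>{1..<k}. 1 / a i)" and "T = (\<Sum>i\<in>{k<..n}. 1 / b i)"
  define D where "D = 1 + a k * H + b k * T"
  define L where "L = eq_level n a b k"
  have "0 \<le> H" "0 \<le> T"
    unfolding H_def T_def by (auto intro!: sum_nonneg simp: less_imp_le a_pos b_pos)
  then have "0 < D"
    using assms(2,3) unfolding D_def by (intro add_pos_nonneg) auto
  have L: "L = (a k + b k) / D"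
    unfolding L_def D_def H_def T_def by (rule eq_level_regular) (use assms in auto)
  then have "0 \<le> L"
    using \<open>0 < D\<close> assms by simp
  \<comment> \<open>Multiplied by \<open>D\<close>, these are exactly the last two assumptions, once
    \<open>a k * H\<close> and \<open>b k * T\<close> cancel.\<close>
  have "L * H \<le> 1" "L * T \<le> 1"
    using assms(6,7) \<open>0 < D\<close> unfolding L D_def H_def[symmetric] T_def[symmetric]
    by (simp_all add: field_simps)
  \<comment> \<open>The weights solve \<open>\<theta> i * a i = L\<close> below \<open>k\<close> and
    \<open>\<phi> i * b i = L\<close> above \<open>k\<close>; what is left of each total weight 1
    goes to \<open>k\<close>.\<close>
  define \<theta> where "\<theta> i = (if i < k then L / a i else if i = k then 1 - L * H else 0)" for i
  define \<phi> where "\<phi> i = (if i < k then 0 else if i = k then 1 - L * T else L / b i)" for i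
  have "(\<Sum>i\<in>{1..<k}. \<theta> i) = L * H" "(\<Sum>i\<in>{k<..n}. \<phi> i) = L * T"
    unfolding H_def T_def sum_distrib_left \<theta>_def \<phi>_def by (auto intro!: sum.cong)
  moreover have "(\<Sum>i\<in>{k<..n}. \<theta> i) = 0" "(\<Sum>i\<in>{1..<k}. \<phi> i) = 0"
    unfolding \<theta>_def \<phi>_def by (auto intro!: sum.neutral)
  ultimately have "(\<Sum>i=1..n. \<theta> i) = 1" "(\<Sum>i=1..n. \<phi> i) = 1"
    unfolding sum_split_at[OF \<open>k \<in> {1..n}\<close>] by (simp_all add: \<theta>_def \<phi>_def)
  moreover have "\<forall>i\<in>{1..n}. 0 \<le> \<theta> i"
    using \<open>0 \<le> L\<close> \<open>L * H \<le> 1\<close> a_pos by (auto simp: \<theta>_def less_imp_le)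
  moreover have "\<forall>i\<in>{1..n}. 0 \<le> \<phi> i"
    using \<open>0 \<le> L\<close> \<open>L * T \<le> 1\<close> b_pos by (auto simp: \<phi>_def less_imp_le)
  \<comment> \<open>Coordinate \<open>k\<close> gets the leftover weights and must also equal
    \<open>L\<close>; this equation is what determines the value of \<open>L\<close>.\<close>
  moreover have "(1 - L * H) * a k + (1 - L * T) * b k = L"
  proof -
    have "L * D = a k + b k"
      using \<open>0 < D\<close> L by simp
    then show ?thesis
      unfolding D_def by (simp add: algebra_simps)
  qed
  then have "y_strategy n a b k = (\<lambda>j. if j \<in> {1..n} then \<theta> j * a j + \<phi> j * b j else 0)"
    unfolding y_strategy_def L_def[symmetric] fun_eq_iff
    using a_pos b_pos by (auto simp: \<theta>_def \<phi>_def indicator_def less_le)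
  ultimately show ?thesis
    unfolding scaled_simplex_plus_eq by blast
qed

section \<open>The guarantee of Player 1\<close>

text \<open>The payoff is a \<open>\<theta>\<close>-average of the \<open>x i * a i\<close> plus a
  \<open>\<phi>\<close>-average of the \<open>x i * b i\<close>, and each average is bounded
  separately.\<close>

lemma payoff_lower_bound:
  assumes "y \<in> scaled_simplex n a + scaled_simplex n b"
    and "\<And>i. i \<in> {1..n} \<Longrightarrow> \<alpha> \<le> x i * a i" "\<And>i. i \<in> {1..n} \<Longrightarrow> \<beta> \<le> x i * b i"
  shows "\<alpha> + \<beta> \<le> payoff n x y"
proof -
  obtain \<theta> \<phi> where y: "y = (\<lambda>j. if j \<in> {1..n} then \<theta> j * a j + \<phi> j * b j else 0)"
    and \<theta>: "\<forall>i\<in>{1..n}. 0 \<le> \<theta> i" "(\<Sum>i=1..n. \<theta> i) = 1"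
    and \<phi>: "\<forall>i\<in>{1..n}. 0 \<le> \<phi> i" "(\<Sum>i=1..n. \<phi> i) = 1"
    using assms(1) unfolding scaled_simplex_plus_eq by blast
  have "\<alpha> + \<beta> = (\<Sum>i=1..n. \<theta> i * \<alpha> + \<phi> i * \<beta>)"
    using \<theta> \<phi> by (simp add: sum.distrib flip: sum_distrib_right)
  also have "\<dots> \<le> (\<Sum>i=1..n. \<theta> i * (x i * a i) + \<phi> i * (x i * b i))"
    using \<theta> \<phi> assms by (intro sum_mono add_mono mult_left_mono) auto
  also have "\<dots> = payoff n x y"
    unfolding payoff_def y by (rule sum.cong) (auto simp: algebra_simps)
  finally show ?thesis .
qed

lemma x_strategy_guarantee:
  assumes k: "k \<in> {1..n}" and "0 \<le> f {1..n}"
    and a: "mono_on {1..n} a" "\<forall>i\<in>{1..n}. 0 \<le> a i"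
    and b: "antimono_on {1..n} b" "\<forall>i\<in>{1..n}. 0 \<le> b i"
    and a_pos: "\<And>i. i \<in> {1..<k} \<Longrightarrow> 0 < a i" and b_pos: "\<And>i. i \<in> {k<..n} \<Longrightarrow> 0 < b i"
    and y: "y \<in> scaled_simplex n a + scaled_simplex n b"
  shows "eq_level n a b k * f {1..n} \<le> payoff n (x_strategy n f a b k) y"
proof -
  define x where "x = x_strategy n f a b k"
  define c where "c = eq_level n a b k * f {1..n} / (a k + b k)"
  have nonneg: "0 \<le> a k" "0 \<le> b k"
    using k a b by auto
  have level: "eq_level n a b k =
    (a k + b k) / (1 + a k * (\<Sum>i\<in>{1..<k}. 1 / a i) + b k * (\<Sum>i\<in>{k<..n}. 1 / b i))"
    by (rule eq_level_regular) (use assms in auto)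
  have "0 \<le> eq_level n a b k"
    unfolding level using nonneg a_pos b_pos
    by (intro divide_nonneg_nonneg add_nonneg_nonneg mult_nonneg_nonneg sum_nonneg)
      (auto simp: less_imp_le)
  then have "0 \<le> c"
    unfolding c_def using nonneg assms(2) by simp
  \<comment> \<open>If \<open>a k + b k = 0\<close>, division by zero gives \<open>c = 0\<close>,
    and the level is 0 as well because of its numerator.\<close>
  have c_total: "eq_level n a b k * f {1..n} = c * a k + c * b k"
    unfolding distrib_left[symmetric] by (cases "a k + b k = 0") (simp_all add: c_def level)
  \<comment> \<open>Below \<open>k\<close> the bound for \<open>a\<close> is an equality, and the
    bound for \<open>b\<close> becomes \<open>b k * a i \<le> a k * b i\<close>, the product of the
    two orderings. Above \<open>k\<close> the roles are exchanged, and at \<open>k\<close> both are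
    equalities.\<close>
  have le: "c * a k \<le> x i * a i \<and> c * b k \<le> x i * b i" if i: "i \<in> {1..n}" for i
  proof -
    consider "i < k" | "i = k" | "k < i" by linarith
    then show ?thesis
    proof cases
      case 1
      then have "0 < a i" using i a_pos by auto
      have x: "x i = c * (a k / a i)"
        using 1 i \<open>0 < a i\<close> by (simp add: x_def x_strategy_def c_def ratio_pos)
      have "a i \<le> a k" "b k \<le> b i"
        using 1 i k a(1) b(1) by (auto simp: monotone_on_def)
      then have "b k * a i \<le> a k * b i"
        using nonneg \<open>0 < a i\<close> by (subst mult.commute) (intro mult_mono, auto)
      then have "b k \<le> a k / a i * b i"
        using \<open>0 < a i\<close> by (simp add: field_simps)
      then show ?thesis
        using mult_left_mono[of "b k" "a k / a i * b i" c] \<open>0 \<le> c\<close> \<open>0 < a i\<close> by (simp add: x mult.assoc)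
    next
      case 2
      then have "x i = c"
        using k nonneg by (simp add: x_def x_strategy_def c_def ratio_self)
      then show ?thesis
        using 2 by simp
    next
      case 3
      then have "0 < b i" using i b_pos by auto
      have x: "x i = c * (b k / b i)"
        using 3 i \<open>0 < b i\<close> by (simp add: x_def x_strategy_def c_def ratio_pos)
      have "a k \<le> a i" "b i \<le> b k"
        using 3 i k a(1) b(1) by (auto simp: monotone_on_def)
      then have "a k * b i \<le> b k * a i"
        using nonneg \<open>0 < b i\<close> by (subst (2) mult.commute) (intro mult_mono, auto)
      then have "a k \<le> b k / b i * a i"
        using \<open>0 < b i\<close> by (simp add: field_simps)
      then show ?thesis
        using mult_left_mono[of "a k" "b k / b i * a i" c] \<open>0 \<le> c\<close> \<open>0 < b i\<close> by (simp add: x mult.assoc)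
    qed
  qed
  show ?thesis
    unfolding c_total x_def[symmetric] by (rule payoff_lower_bound[OF y]) (use le in auto)
qed

section \<open>Regular and degenerate cases of the game\<close>

theorem theorem4:
  fixes n k :: nat
    and f :: "nat set \<Rightarrow> real"
    and a b :: "nat \<Rightarrow> real"
  assumes "1 \<le> n"
    and "\<forall>S. S \<subseteq> {1..n} \<longrightarrow> 0 \<le> f S"
    and "mono_on (Pow {1..n}) f"
    and "submodular_on {1..n} f"
    and "f {} = 0"
    and "\<forall>i\<in>{1..n}. 0 \<le> a i"
    and "\<forall>i\<in>{1..n}. 0 \<le> b i"
    and "mono_on {1..n} a"
    and "antimono_on {1..n} b"
    and "k = switch_index n a b"
  defines "X \<equiv> base_polytope n f"
    and "Y \<equiv> scaled_simplex n a + scaled_simplex n b"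
    and "v \<equiv> eq_level n a b k * f {1..n}"
  shows "y_strategy n a b k \<in> Y \<and>
    (\<forall>x\<in>X. payoff n x (y_strategy n a b k) \<le> v) \<and>
    (x_strategy n f a b k \<in> X \<longrightarrow>
       minmax_optimal X Y (payoff n) (y_strategy n a b k) \<and>
       maxmin_optimal X Y (payoff n) (x_strategy n f a b k) \<and>
       is_game_value X Y (payoff n) v)"
proof -
  have nonneg: "0 \<le> a i" "0 \<le> b i" if "i \<in> {1..n}" for i
    using that assms(6,7) by auto
  note switch = switch_index_properties[OF assms(1) nonneg(2) assms(10) nonneg(1)]
  have k: "k \<in> {1..n}"
    by (rule switch(1))
  \<comment> \<open>A zero of \<open>a\<close> before \<open>k\<close> would make the smaller side
    of the strict inequality at \<open>k - 1\<close> infinite.\<close>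
  have a_pos: "0 < a i" if "i \<in> {1..<k}" for i
  proof (rule ccontr)
    assume "\<not> 0 < a i"
    then have "a i = 0"
      using nonneg(1)[of i] that k by auto
    then have "(\<Sum>i\<in>{1..<k}. 1 / ereal (a i)) = \<infinity>"
      using that by (auto simp: sum_Pinfty)
    then show False
      using switch(3) by simp
  qed
  \<comment> \<open>The inequality at \<open>k\<close> is not strict, so a zero of \<open>b\<close>
    beyond \<open>k\<close> cannot be excluded; it forms the degenerate case.\<close>
  have y: "y_strategy n a b k \<in> Y \<and> (\<forall>y\<in>Y. v \<le> payoff n (x_strategy n f a b k) y)"
  proof (cases "\<forall>i\<in>{k<..n}. 0 < b i")
    case True
    then have b_pos: "0 < b i" if "i \<in> {k<..n}" for i
      using that by blast
    define H T where "H = (\<Sum>i\<in>{1..<k}. 1 / a i)" and "T = (\<Sum>i\<in>{k<..n}. 1 / b i)"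
    have HT: "(\<Sum>i\<in>{1..<k}. 1 / ereal (a i)) = ereal H" "(\<Sum>i\<in>{k<..n}. 1 / ereal (b i)) = ereal T"
      unfolding H_def T_def by (auto intro!: sum_recip_ereal a_pos b_pos)
    \<comment> \<open>The switching inequalities are cleared of \<open>1 / b k\<close> and
      \<open>1 / a k\<close>. Where such a reciprocal is infinite, the cleared form is
      trivial.\<close>
    have "b k * H \<le> 1 + b k * T"
    proof (cases "b k = 0")
      case False
      then have "0 < b k"
        using nonneg(2)[OF k] by simp
      then have "H < 1 / b k + T"
        using switch(3) by (simp add: HT recip_pos del: One_nat_def)
      then show ?thesis
        using \<open>0 < b k\<close> by (simp add: field_simps)
    qed simp
    moreover have "a k * T \<le> 1 + a k * H"
    proof (cases "a k = 0")
      case False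
      then have "0 < a k"
        using nonneg(1)[OF k] by simp
      then have "T \<le> H + 1 / a k"
        using switch(2) by (simp add: HT recip_pos del: One_nat_def)
      then show ?thesis
        using \<open>0 < a k\<close> by (simp add: field_simps)
    qed simp
    ultimately have "y_strategy n a b k \<in> Y"
      unfolding Y_def H_def T_def using k nonneg a_pos b_pos
      by (intro y_strategy_mem_regular) auto
    moreover have "v \<le> payoff n (x_strategy n f a b k) y" if "y \<in> Y" for y
      unfolding v_def using assms(2,6-9) k a_pos b_pos that
      by (intro x_strategy_guarantee) (auto simp: Y_def)
    ultimately show ?thesis
      by blast
  next
    case False
    then obtain j where j: "j \<in> {k<..n}" "b j = 0"
      using k nonneg(2) by (metis atLeastAtMost_iff greaterThanAtMost_iff le_trans less_eq_real_def less_imp_le)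
    then have "(\<Sum>i\<in>{k<..n}. 1 / ereal (b i)) = \<infinity>"
      by (auto simp: sum_Pinfty)
    \<comment> \<open>The sum before \<open>k\<close> is finite by \<open>a_pos\<close>, so the
      infinity must come from \<open>1 / a k\<close>, which forces \<open>a k = 0\<close>.\<close>
    then have "(\<Sum>i\<in>{1..<k}. 1 / ereal (a i)) + 1 / ereal (a k) = \<infinity>"
      using switch(2) by simp
    moreover have "(\<Sum>i\<in>{1..<k}. 1 / ereal (a i)) = ereal (\<Sum>i\<in>{1..<k}. 1 / a i)"
      by (rule sum_recip_ereal) (rule a_pos)
    ultimately have "a k = 0"
      using nonneg(1)[OF k] by (cases "a k = 0") (auto simp: recip_pos)
    then have level: "eq_level n a b k = 0"
      using j k nonneg(2) by (intro eq_level_degenerate[of _ _ _ j]) auto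
    \<comment> \<open>With \<open>a k = 0\<close> and \<open>b j = 0\<close>, the pure strategy
      \<open>(k, j)\<close> is the zero vector, which is \<open>y_strategy\<close> at level
      0.\<close>
    define \<theta> \<phi> :: "nat \<Rightarrow> real"
      where "\<theta> i = (if i = k then 1 else 0)" and "\<phi> i = (if i = j then 1 else 0)" for i
    have "y_strategy n a b k = (\<lambda>i. if i \<in> {1..n} then \<theta> i * a i + \<phi> i * b i else 0)"
      using \<open>a k = 0\<close> \<open>b j = 0\<close> by (auto simp: y_strategy_def level \<theta>_def \<phi>_def)
    moreover have "(\<Sum>i=1..n. \<theta> i) = 1" "(\<Sum>i=1..n. \<phi> i) = 1"
      using k j by (auto simp: \<theta>_def \<phi>_def)
    moreover have "\<forall>i\<in>{1..n}. 0 \<le> \<theta> i" "\<forall>i\<in>{1..n}. 0 \<le> \<phi> i"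
      by (simp_all add: \<theta>_def \<phi>_def)
    ultimately have "y_strategy n a b k \<in> Y"
      unfolding Y_def scaled_simplex_plus_eq by blast
    \<comment> \<open>Level 0 makes both \<open>x_strategy\<close> and \<open>v\<close> zero, so the
      guarantee is an equality.\<close>
    moreover have "payoff n (x_strategy n f a b k) y = 0" for y
      by (simp add: payoff_def x_strategy_def level)
    ultimately show ?thesis
      by (simp add: v_def level)
  qed
  have le: "payoff n x (y_strategy n a b k) \<le> v" if "x \<in> X" for x
  proof -
    have "payoff n x (y_strategy n a b k) = eq_level n a b k * (\<Sum>i=1..n. x i)"
      unfolding payoff_def y_strategy_def sum_distrib_left by (rule sum.cong) auto
    then show ?thesis
      using that by (simp add: X_def v_def base_polytope_def)
  qed
  show ?thesis
  proof (intro conjI impI ballI)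
    assume "x_strategy n f a b k \<in> X"
    note saddle = saddle_point_optimal[where P = "payoff n", OF this conjunct1[OF y] le]
    show "minmax_optimal X Y (payoff n) (y_strategy n a b k)"
      "maxmin_optimal X Y (payoff n) (x_strategy n f a b k)"
      "is_game_value X Y (payoff n) v"
      by (rule saddle; use y in blast)+
  qed (use y le in auto)
qed

end
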